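(* For every integer $n\ge 2$ and every integer $m\ge 1$, $$s_{n,m}=-\sum_{i=2}^{n}c_{i,-(m+1)},$$ where $s_{n,m}=\sum_{k=1}^{n(n+1)/2}(a_{n,k})^m$ is the $m$-th power sum of the roots $a_{n,k}\in\mathbb{C}$ (counted with multiplicity) of the polynomial $Q_n^{[3]}(z)$, and $c_{i,-(m+1)}$ is the coefficient of $z^{-(m+1)}$ in the formal power expansion at $z=\infty$, at $\alpha=i$, of solutions of the sixth-order equation $$w_{zzzzzz}-14w^2w_{zzzz}-56ww_zw_{zzz}-42ww_{zz}^2-70w_z^2w_{zz}+70w^4w_{zz}+140w^3w_z^2-20w^7-zw-\alpha=0.$$
   Context: The polynomials $Q_n^{[3]}(z)$, $n\ge0$, are the special polynomials associated with rational solutions of the equation $w_{zzzzzz}-14w^2w_{zzzz}-56ww_zw_{zzz}-42ww_{zz}^2-70w_z^2w_{zz}+70w^4w_{zz}+140w^3w_z^2-20w^7-zw-\alpha=0$: $Q_0^{[3]}(z)=1$, each $Q_n^{[3]}$ is a monic polynomial of degree $n(n+1)/2$, and for every $n\ge1$ the function $w(z;n)=\frac{d}{dz}\ln\frac{Q^{[3]}_{n-1}(z)}{Q^{[3]}_n(z)}$ is a rational solution of this equation with $\alpha=n$. (The existence of these polynomials is taken as given.) Expansion at infinity: for each $\alpha$ the equation has a unique formal solution of the form $w(z;\alpha)=\frac{c_{\alpha,-1}}{z}+\sum_{l=1}^{\infty}c_{\alpha,-7l-1}z^{-7l-1}$ (with $c_{\alpha,-1}=-\alpha$). It is also written $w(z;\alpha)=\sum_{m=0}^{\infty}c_{\alpha,-(m+1)}z^{-(m+1)}$,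 where $c_{\alpha,-(m+1)}=0$ unless $m$ is divisible by $7$. *)

theory Defs
  imports
    "HOL-Analysis.Analysis"
    "HOL-Computational_Algebra.Formal_Laurent_Series"
begin

text \<open>
  The left-hand side of the sixth-order equation. The argument \<open>u\<close> lists the derivatives
  of the unknown: \<open>u k\<close> stands for the \<open>k\<close>-th derivative with respect to \<open>z\<close>.
  The same expression is used pointwise for complex functions and for formal Laurent series.
\<close>

definition sixth_order_lhs :: "'a \<Rightarrow> 'a \<Rightarrow> (nat \<Rightarrow> 'a) \<Rightarrow> 'a::comm_ring_1" where
  "sixth_order_lhs \<alpha> z u =
     u 6 - 14 * u 0 ^ 2 * u 4 - 56 * u 0 * u 1 * u 3 - 42 * u 0 * u 2 ^ 2
       - 70 * u 1 ^ 2 * u 2 + 70 * u 0 ^ 4 * u 2 + 140 * u 0 ^ 3 * u 1 ^ 2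
       - 20 * u 0 ^ 7 - z * u 0 - \<alpha>"

text \<open>
  \<open>log_deriv f\<close> is the rational function (d/dz) ln f; no branch of the logarithm is chosen.
\<close>

definition log_deriv :: "(complex \<Rightarrow> complex) \<Rightarrow> complex \<Rightarrow> complex" where
  "log_deriv f z = deriv f z / f z"

definition w_fun :: "(nat \<Rightarrow> complex poly) \<Rightarrow> nat \<Rightarrow> complex \<Rightarrow> complex" where
  "w_fun Q n = log_deriv (\<lambda>z. poly (Q (n - 1)) z / poly (Q n) z)"

text \<open>
  The sequence of special polynomials. A rational function solves the equation iff the equation
  holds away from the finitely many zeros of \<open>Q (n - 1)\<close> and \<open>Q n\<close>.
\<close>

definition special_polynomials :: "(nat \<Rightarrow> complex poly) \<Rightarrow> bool" where
  "special_polynomials Q \<longleftrightarrow>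
     Q 0 = 1 \<and>
     (\<forall>n. lead_coeff (Q n) = 1 \<and> degree (Q n) = n * (n + 1) div 2) \<and>
     (\<forall>n\<ge>1. \<forall>z. poly (Q (n - 1)) z \<noteq> 0 \<longrightarrow> poly (Q n) z \<noteq> 0 \<longrightarrow>
        sixth_order_lhs (of_nat n) z (\<lambda>k. (deriv ^^ k) (w_fun Q n) z) = 0)"

text \<open>
  Formal series at infinity are Laurent series in the local variable 1/z: \<open>fls_X\<close> is 1/z,
  the series z is \<open>fls_X_inv\<close>, and the coefficient of \<open>z\<close> to the power \<open>j\<close> has index \<open>- j\<close>.
  By the chain rule d/dz acts as \<open>- fls_X\<^sup>2\<close> times the derivative in the local variable.
\<close>

definition deriv_inf :: "complex fls \<Rightarrow> complex fls" where
  "deriv_inf W = - (fls_X ^ 2) * fls_deriv W"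

definition formal_solution_inf :: "complex \<Rightarrow> complex fls \<Rightarrow> bool" where
  "formal_solution_inf \<alpha> W \<longleftrightarrow>
     (\<forall>j. fls_nth W j \<noteq> 0 \<longrightarrow> (\<exists>l::nat. j = 7 * int l + 1)) \<and>
     sixth_order_lhs (fls_const \<alpha>) fls_X_inv (\<lambda>k. (deriv_inf ^^ k) W) = 0"

definition w_inf :: "complex \<Rightarrow> complex fls" where
  "w_inf \<alpha> = (THE W. formal_solution_inf \<alpha> W)"

text \<open>\<open>c_inf \<alpha> j\<close> is the coefficient of \<open>z\<close> to the (negative) power \<open>j\<close>.\<close>

definition c_inf :: "complex \<Rightarrow> int \<Rightarrow> complex" where
  "c_inf \<alpha> j = fls_nth (w_inf \<alpha>) (- j)"

text \<open>
  The description used in \<open>w_inf\<close> is proper: the equation is equivalent to a fixed point equation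
  for an operator on power series in 1/z that is contracting for the degree of agreement.
\<close>

context
begin

private definition D :: "complex fps \<Rightarrow> complex fps" where
  "D F = - (fps_X ^ 2) * fps_deriv F"

private definition T :: "complex \<Rightarrow> complex fps \<Rightarrow> complex fps" where
  "T \<alpha> F = fps_X * (sixth_order_lhs (fps_const \<alpha>) 0 (\<lambda>k. (D ^^ k) F))"

private definition agree :: "nat \<Rightarrow> complex fps \<Rightarrow> complex fps \<Rightarrow> bool" where
  "agree k F G \<longleftrightarrow> (\<forall>j<k. F $ j = G $ j)"

private definition graded :: "nat \<Rightarrow> complex fps \<Rightarrow> bool" where
  "graded r F \<longleftrightarrow> (\<forall>j. F $ j \<noteq> 0 \<longrightarrow> j mod 7 = r mod 7)"

private lemma agree_refl: "agree k F F"
  by (simp add: agree_def)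

private lemma agree_add: "agree k F G \<Longrightarrow> agree k F' G' \<Longrightarrow> agree k (F + F') (G + G')"
  by (simp add: agree_def)

private lemma agree_diff: "agree k F G \<Longrightarrow> agree k F' G' \<Longrightarrow> agree k (F - F') (G - G')"
  by (simp add: agree_def)

private lemma agree_mult: "agree k F G \<Longrightarrow> agree k F' G' \<Longrightarrow> agree k (F * F') (G * G')"
  by (auto simp: agree_def fps_mult_nth intro!: sum.cong)

private lemma agree_power: "agree k F G \<Longrightarrow> agree k (F ^ n) (G ^ n)"
  by (induction n) (auto intro: agree_mult agree_refl)

private lemma D_nth: "D F $ j = - (of_nat (j - 1) * F $ (j - 1))"
proof -
  have "D F $ j = - ((fps_X ^ 2 * fps_deriv F) $ j)"
    by (simp add: D_def)
  also have "\<dots> = - (if j < 2 then 0 else fps_deriv F $ (j - 2))"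
    by (subst fps_X_power_mult_nth) simp
  also have "\<dots> = - (of_nat (j - 1) * F $ (j - 1))"
  proof (cases "j < 2")
    case False
    then obtain i where "j = Suc (Suc i)" by (metis add_2_eq_Suc not_less le_Suc_ex)
    then show ?thesis by simp
  qed auto
  finally show ?thesis .
qed

private lemma agree_D: "agree k F G \<Longrightarrow> agree k (D F) (D G)"
  by (auto simp: agree_def D_nth)

private lemma agree_D_iter: "agree k F G \<Longrightarrow> agree k ((D ^^ n) F) ((D ^^ n) G)"
  by (induction n) (auto intro: agree_D)

private lemma agree_T: assumes "agree k F G" shows "agree (Suc k) (T \<alpha> F) (T \<alpha> G)"
proof -
  have "agree k (sixth_order_lhs (fps_const \<alpha>) 0 (\<lambda>k. (D ^^ k) F))
                (sixth_order_lhs (fps_const \<alpha>) 0 (\<lambda>k. (D ^^ k) G))"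
    unfolding sixth_order_lhs_def
    by (intro agree_add agree_diff agree_mult agree_power agree_refl agree_D_iter assms)
  thus ?thesis by (auto simp: agree_def T_def)
qed

private lemma T_fixpoint_unique: assumes "T \<alpha> F = F" "T \<alpha> G = G" shows "F = G"
proof -
  have "agree k F G" for k
  proof (induction k)
    case (Suc k)
    then show ?case using agree_T[of k F G \<alpha>] assms by simp
  qed (simp add: agree_def)
  thus ?thesis by (auto simp: agree_def fps_eq_iff)
qed

private lemma graded_0: "graded r 0"
  by (simp add: graded_def)

private lemma graded_add: "graded r F \<Longrightarrow> graded r G \<Longrightarrow> graded r (F + G)"
  unfolding graded_def fps_add_nth by (metis add_0)

private lemma graded_diff: "graded r F \<Longrightarrow> graded r G \<Longrightarrow> graded r (F - G)"
  unfolding graded_def fps_sub_nth by (metis diff_zero)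

private lemma graded_mult:
  assumes "graded r F" "graded s G" shows "graded (r + s) (F * G)"
  unfolding graded_def
proof (intro allI impI)
  fix j assume "(F * G) $ j \<noteq> 0"
  then obtain i where i: "i \<le> j" "F $ i * G $ (j - i) \<noteq> 0"
    unfolding fps_mult_nth by (metis (no_types, lifting) atLeastAtMost_iff sum.neutral)
  hence "i mod 7 = r mod 7" "(j - i) mod 7 = s mod 7" using assms by (auto simp: graded_def)
  hence "(i + (j - i)) mod 7 = (r + s) mod 7" by (rule mod_add_cong)
  thus "j mod 7 = (r + s) mod 7" using i by simp
qed

private lemma graded_const: "graded 0 (fps_const x)"
  by (simp add: graded_def)

private lemma graded_numeral: "graded 0 (numeral x)"
  by (simp add: numeral_fps_const graded_const)

private lemma graded_power: "graded r F \<Longrightarrow> graded (n * r) (F ^ n)"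
proof (induction n)
  case 0
  then show ?case using graded_const[of 1] by simp
next
  case (Suc n)
  then show ?case using graded_mult[of r F "n * r" "F ^ n"] by simp
qed

private lemma graded_D: "graded r F \<Longrightarrow> graded (Suc r) (D F)"
  unfolding graded_def
proof (intro allI impI)
  fix j assume F: "\<forall>j. F $ j \<noteq> 0 \<longrightarrow> j mod 7 = r mod 7" and "D F $ j \<noteq> 0"
  hence "j - 1 \<noteq> 0" "F $ (j - 1) \<noteq> 0" by (auto simp: D_nth)
  hence "j = Suc (j - 1)" "(j - 1) mod 7 = r mod 7" using F by auto
  thus "j mod 7 = Suc r mod 7" by (metis mod_Suc_eq)
qed

private lemma graded_D_iter: "graded r F \<Longrightarrow> graded (n + r) ((D ^^ n) F)"
  by (induction n) (auto intro: graded_D)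

private lemma graded_cong: "graded r F \<Longrightarrow> r mod 7 = s mod 7 \<Longrightarrow> graded s F"
  unfolding graded_def by (metis)

private lemma graded_T: assumes "graded 1 F" shows "graded 1 (T \<alpha> F)"
proof -
  have d: "graded (k + 1) ((D ^^ k) F)" for k
    using graded_D_iter[OF assms] by simp
  note m = graded_mult and p = graded_power[OF d] and q = graded_numeral
  have g: "graded 0 H" if "graded r H" "r mod 7 = 0" for r H
    using graded_cong[OF that(1), of 0] that(2) by simp
  have t: "graded 0 (sixth_order_lhs (fps_const \<alpha>) 0 (\<lambda>k. (D ^^ k) F))"
    unfolding sixth_order_lhs_def mult_zero_left
    apply (intro graded_add graded_diff graded_const graded_0)
    apply (rule g[OF d]; simp)
    apply (rule g[OF m[OF m[OF q p] d]]; simp)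
    apply (rule g[OF m[OF m[OF m[OF q d] d] d]]; simp)
    apply (rule g[OF m[OF m[OF q d] p]]; simp)
    apply (rule g[OF m[OF m[OF q p] d]]; simp)
    apply (rule g[OF m[OF m[OF q p] d]]; simp)
    apply (rule g[OF m[OF m[OF q p] p]]; simp)
    apply (rule g[OF m[OF q p]]; simp)
    done
  have "graded 1 fps_X" by (simp add: graded_def fps_X_def)
  from graded_mult[OF this t] show ?thesis by (simp add: T_def)
qed

private lemma T_fixpoint_exists: "\<exists>F. T \<alpha> F = F \<and> graded 1 F"
proof -
  define G where "G n = (T \<alpha> ^^ n) 0" for n
  define F where "F = Abs_fps (\<lambda>j. G (Suc j) $ j)"
  have step: "agree n (G n) (G (Suc n))" for n
  proof (induction n)
    case (Suc n)
    then show ?case using agree_T[of n "G n" "G (Suc n)" \<alpha>] by (simp add: G_def)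
  qed (simp add: agree_def)
  have st: "j < n \<Longrightarrow> G n $ j = G (Suc j) $ j" for n j
  proof (induction n)
    case (Suc n)
    then show ?case using step[of n] by (cases "j = n") (auto simp: agree_def)
  qed simp
  have FG: "agree n F (G n)" for n
    unfolding agree_def F_def by (metis fps_nth_Abs_fps st)
  have "T \<alpha> F $ j = F $ j" for j
  proof -
    have "T \<alpha> F $ j = T \<alpha> (G (Suc j)) $ j"
      using agree_T[OF FG[of "Suc j"], of \<alpha>] by (simp add: agree_def)
    also have "\<dots> = G (Suc (Suc j)) $ j" by (simp add: G_def)
    also have "\<dots> = F $ j" using FG[of "Suc (Suc j)"] by (simp add: agree_def)
    finally show ?thesis .
  qed
  hence "T \<alpha> F = F" by (simp add: fps_eq_iff)
  moreover have "graded 1 (G n)" for n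
    by (induction n) (use graded_T in \<open>auto simp: G_def graded_0\<close>)
  hence "graded 1 F" by (auto simp: graded_def F_def)
  ultimately show ?thesis by blast
qed

private lemma deriv_inf_fps: "(deriv_inf ^^ k) (fps_to_fls F) = fps_to_fls ((D ^^ k) F)"
  by (induction k)
     (simp_all add: deriv_inf_def D_def fls_deriv_fps_to_fls fls_times_fps_to_fls fps_to_fls_power)

private lemma lhs_eq_0_iff:
  "sixth_order_lhs (fls_const \<alpha>) fls_X_inv (\<lambda>k. (deriv_inf ^^ k) (fps_to_fls F)) = 0
     \<longleftrightarrow> T \<alpha> F = F"
proof -
  let ?P = "sixth_order_lhs (fps_const \<alpha>) 0 (\<lambda>k. (D ^^ k) F)"
  have "sixth_order_lhs (fls_const \<alpha>) fls_X_inv (\<lambda>k. (deriv_inf ^^ k) (fps_to_fls F))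
          = fps_to_fls ?P - fls_X_inv * fps_to_fls F"
    by (simp only: deriv_inf_fps)
       (simp add: sixth_order_lhs_def fls_times_fps_to_fls fps_to_fls_power)
  moreover have "fls_X * (fps_to_fls ?P - fls_X_inv * fps_to_fls F) = fps_to_fls (T \<alpha> F - F)"
    by (simp add: T_def fls_times_fps_to_fls right_diff_distrib
          fls_X_times_conv_shift fls_X_inv_times_conv_shift)
  moreover have "(fls_X :: complex fls) \<noteq> 0" by simp
  ultimately show ?thesis
    by (metis eq_iff_diff_eq_0 fps_to_fls_eq_0_iff mult_eq_0_iff)
qed

lemma formal_solution_inf_ex1: "\<exists>!W. formal_solution_inf \<alpha> W"
proof (rule ex_ex1I)
  obtain F where F: "T \<alpha> F = F" "graded 1 F" using T_fixpoint_exists by blast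
  have "\<exists>l::nat. j = 7 * int l + 1" if "fls_nth (fps_to_fls F) j \<noteq> 0" for j
  proof -
    from that have j: "j \<ge> 0" "F $ nat j \<noteq> 0" by (auto split: if_splits)
    hence "nat j mod 7 = 1" using F(2) by (auto simp: graded_def )
    then obtain l where "nat j = 7 * l + 1" by (metis mult_div_mod_eq)
    hence "j = 7 * int l + 1" using j(1) by linarith
    thus ?thesis by blast
  qed
  thus "\<exists>W. formal_solution_inf \<alpha> W"
    unfolding formal_solution_inf_def using lhs_eq_0_iff F(1) by blast
next
  have reg: "\<exists>F. W = fps_to_fls F \<and> T \<alpha> F = F" if "formal_solution_inf \<alpha> W" for W
  proof -
    have "fls_subdegree W \<ge> 0"
      using that by (intro fls_subdegree_ge0I) (force simp: formal_solution_inf_def)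
    hence "W = fps_to_fls (fls_regpart W)" by simp
    thus ?thesis using that lhs_eq_0_iff unfolding formal_solution_inf_def by metis
  qed
  fix V W assume "formal_solution_inf \<alpha> V" "formal_solution_inf \<alpha> W"
  thus "V = W" using reg T_fixpoint_unique by metis
qed

end

end

theory Submission
  imports Defs "HOL-Computational_Algebra.Fundamental_Theorem_Algebra"
begin

text \<open>
  Write \<open>s i m\<close> for the \<open>m\<close>-th power sum of the roots of \<open>Q i\<close>; it is the coefficient of
  \<open>z\<close> to the power \<open>- (m + 1)\<close> in the expansion of \<open>Q i' / Q i\<close> at infinity, so \<open>w(z;i)\<close>
  expands with coefficients \<open>s (i - 1) m - s i m\<close>. Clearing denominators turns the equation for
  the function \<open>w(z;i)\<close> into a polynomial identity, which then also holds for the expansion.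
  The equation determines a power series solution in \<open>1/z\<close> uniquely, because the term \<open>z w\<close>
  expresses each coefficient by the earlier ones. Hence these differences are the coefficients
  of the formal solution, and their sum over \<open>i\<close> telescopes to \<open>s 1 m - s n m\<close>. Since the formal
  solution has no term in \<open>z\<close> to the power \<open>-2\<close>, the single root of \<open>Q 1\<close> is \<open>0\<close>, and
  \<open>s 1 m = 0\<close>.
\<close>

section \<open>Homogeneity and congruences of the sixth-order expression\<close>

text \<open>Give \<open>u k\<close> weight k + 1, \<open>z\<close> weight 6 and \<alpha> weight 7:
  every term then has weight 7. This is what later clears the denominators \<open>M ^ Suc k\<close>
  of the k-th derivatives all at once.\<close>

lemma sixth_order_lhs_scale:
  fixes x :: "'a::comm_ring_1"
  shows "sixth_order_lhs (\<alpha> * x ^ 7) (z * x ^ 6) (\<lambda>k. x ^ Suc k * u k)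
    = x ^ 7 * sixth_order_lhs \<alpha> z u"
  unfolding sixth_order_lhs_def by (simp add: algebra_simps eval_nat_numeral)

lemma dvd_diff_mult:
  fixes a b c d x :: "'a::comm_ring_1"
  assumes "x dvd a - b" "x dvd c - d"
  shows "x dvd a * c - b * d"
proof -
  have "a * c - b * d = (a - b) * c + b * (c - d)"
    by (simp add: algebra_simps)
  then show ?thesis using assms by simp
qed

lemma dvd_diff_power:
  fixes a b x :: "'a::comm_ring_1"
  shows "x dvd a - b \<Longrightarrow> x dvd a ^ n - b ^ n"
  by (induction n) (auto intro: dvd_diff_mult)

text \<open>The expression is a polynomial in the \<open>u k\<close>, so it respects congruence
  modulo \<open>x\<close>. Here \<open>x\<close> will be a power of \<open>fps_X\<close>.\<close>

lemma dvd_diff_sixth_order_lhs: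
  fixes x :: "'a::comm_ring_1"
  assumes "\<And>k. x dvd u k - v k"
  shows "x dvd sixth_order_lhs \<alpha> z u - sixth_order_lhs \<alpha> z v"
proof -
  have add: "x dvd (a + c) - (b + d)" if "x dvd a - b" "x dvd c - d" for a b c d
    using dvd_add[OF that] by (simp add: algebra_simps)
  have diff: "x dvd (a - c) - (b - d)" if "x dvd a - b" "x dvd c - d" for a b c d
    using dvd_diff[OF that] by (simp add: algebra_simps)
  have refl: "x dvd a - a" for a by simp
  show ?thesis
    unfolding sixth_order_lhs_def
    by (intro add diff dvd_diff_mult dvd_diff_power assms refl)
qed

section \<open>Uniqueness of power series solutions in 1/z\<close>

text \<open>Counterpart of \<open>deriv_inf\<close> on power series. Divisibility by
  \<open>fps_X ^ n\<close> expresses agreement of the first n coefficients there, whereas in the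
  field of Laurent series it would say nothing.\<close>

definition fps_deriv_inf :: "complex fps \<Rightarrow> complex fps" where
  "fps_deriv_inf F = - (fps_X ^ 2) * fps_deriv F"

lemma deriv_inf_fps_to_fls: "(deriv_inf ^^ k) (fps_to_fls F) = fps_to_fls ((fps_deriv_inf ^^ k) F)"
  by (induction k)
     (simp_all add: deriv_inf_def fps_deriv_inf_def fls_deriv_fps_to_fls fls_times_fps_to_fls
        fps_to_fls_power)

text \<open>d/dz acts as -X^2 d/dX, which never lowers the order of a series and so preserves the
  ideal generated by \<open>fps_X ^ n\<close>.\<close>

lemma fps_X_power_dvd_deriv_inf:
  assumes "fps_X ^ n dvd F - G"
  shows "fps_X ^ n dvd (fps_deriv_inf ^^ k) F - (fps_deriv_inf ^^ k) G"
proof (induction k)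
  case (Suc k)
  then obtain H where H: "(fps_deriv_inf ^^ k) F - (fps_deriv_inf ^^ k) G = fps_X ^ n * H"
    by blast
  have "(fps_deriv_inf ^^ Suc k) F - (fps_deriv_inf ^^ Suc k) G
          = - (fps_X ^ 2) * fps_deriv (fps_X ^ n * H)"
    by (simp add: fps_deriv_inf_def right_diff_distrib flip: H)
  also have "\<dots> = - (fps_X ^ 2) * fps_X ^ n * fps_deriv H
      - fps_X * (fps_X * fps_deriv (fps_X ^ n)) * H"
    by (simp add: algebra_simps power2_eq_square)
  \<comment> \<open>The Euler operator X d/dX multiplies \<open>fps_X ^ n\<close> by n. Keeping the
    factor \<open>fps_X\<close> avoids the exponent n - 1 and a separate case n = 0.\<close>
  also have "fps_X * fps_deriv (fps_X ^ n :: complex fps) = of_nat n * fps_X ^ n"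
    by (induction n) (simp_all add: algebra_simps)
  also have "- (fps_X ^ 2) * fps_X ^ n * fps_deriv H - fps_X * (of_nat n * fps_X ^ n) * H
      = fps_X ^ n * (- (fps_X ^ 2) * fps_deriv H - of_nat n * fps_X * H)"
    by (simp add: algebra_simps)
  finally show ?case by (metis dvd_triv_left)
qed (use assms in simp)

lemma sixth_order_fps_solution_unique:
  assumes "sixth_order_lhs (fls_const \<alpha>) fls_X_inv (\<lambda>k. (deriv_inf ^^ k) (fps_to_fls F)) = 0"
    and "sixth_order_lhs (fls_const \<alpha>) fls_X_inv (\<lambda>k. (deriv_inf ^^ k) (fps_to_fls G)) = 0"
  shows "F = G"
proof -
  \<comment> \<open>Putting 0 in place of z removes exactly the term z w, so the equation reads
    \<open>R F\<close> = z F, and multiplying by 1/z gives a fixed point equation.\<close>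
  define R where "R F = sixth_order_lhs (fps_const \<alpha>) 0 (\<lambda>k. (fps_deriv_inf ^^ k) F)" for F
  have fixpoint: "F = fps_X * R F"
    if "sixth_order_lhs (fls_const \<alpha>) fls_X_inv (\<lambda>k. (deriv_inf ^^ k) (fps_to_fls F)) = 0" for F
  proof -
    have "fps_to_fls (R F) = fls_X_inv * fps_to_fls F"
      using that
      by (simp only: deriv_inf_fps_to_fls)
         (simp add: R_def sixth_order_lhs_def fls_times_fps_to_fls fps_to_fls_power algebra_simps)
    then have "fls_X * fps_to_fls (R F) = fps_to_fls F"
      by (simp add: fls_X_times_conv_shift fls_X_inv_times_conv_shift)
    then show ?thesis
      by (metis fps_X_to_fls fls_times_fps_to_fls fps_to_fls_eq_iff)
  qed
  have "fps_X ^ n dvd F - G" for n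
  proof (induction n)
    case (Suc n)
    have "fps_X ^ n dvd R F - R G"
      unfolding R_def by (intro dvd_diff_sixth_order_lhs fps_X_power_dvd_deriv_inf Suc)
    \<comment> \<open>The extra factor \<open>fps_X\<close> turns agreement to order n into
      agreement to order n + 1.\<close>
    moreover have "F - G = fps_X * (R F - R G)"
      using fixpoint[OF assms(1)] fixpoint[OF assms(2)] by (simp add: right_diff_distrib)
    ultimately show ?case by (simp add: mult_dvd_mono)
  qed simp
  then have "(F - G) $ n = 0" for n
    by (metis dvdE fps_X_power_mult_nth lessI)
  then show ?thesis by (simp add: fps_eq_iff)
qed

text \<open>The exponents allowed in \<open>w_inf\<close> make it a power series in 1/z, so
  uniqueness identifies it with \<open>F\<close>. The sparsity modulo 7 is not assumed of
  \<open>F\<close>; it is inherited from \<open>w_inf\<close>.\<close>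

lemma c_inf_eq_fps_nth:
  fixes F :: "complex fps"
  assumes "sixth_order_lhs (fls_const \<alpha>) fls_X_inv (\<lambda>k. (deriv_inf ^^ k) (fps_to_fls F)) = 0"
  shows "c_inf \<alpha> (- int j) = F $ j"
    and "F $ j \<noteq> 0 \<Longrightarrow> j mod 7 = 1"
proof -
  have W: "formal_solution_inf \<alpha> (w_inf \<alpha>)"
    unfolding w_inf_def by (rule theI'[OF formal_solution_inf_ex1])
  then have "fls_subdegree (w_inf \<alpha>) \<ge> 0"
    by (intro fls_subdegree_ge0I) (force simp: formal_solution_inf_def)
  then have "w_inf \<alpha> = fps_to_fls (fls_regpart (w_inf \<alpha>))" by simp
  with W assms have eq: "w_inf \<alpha> = fps_to_fls F"
    unfolding formal_solution_inf_def by (metis sixth_order_fps_solution_unique)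
  show "c_inf \<alpha> (- int j) = F $ j"
    by (simp add: c_inf_def eq)
  assume "F $ j \<noteq> 0"
  then have "fls_nth (w_inf \<alpha>) (int j) \<noteq> 0" by (simp add: eq)
  with W obtain l :: nat where "int j = 7 * int l + 1"
    unfolding formal_solution_inf_def by blast
  then have "j = 7 * l + 1" by linarith
  then show "j mod 7 = 1" by simp
qed

section \<open>Expansion of polynomials at infinity\<close>

text \<open>Substitution of z, that is \<open>fls_X_inv\<close>. The lemmas below make it a ring
  homomorphism carrying \<open>pderiv\<close> to \<open>deriv_inf\<close>, so polynomial identities
  transfer to Laurent series.\<close>

definition poly_inf :: "complex poly \<Rightarrow> complex fls" where
  "poly_inf p = poly (map_poly fls_const p) fls_X_inv"

lemma poly_inf_0 [simp]: "poly_inf 0 = 0"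
  by (simp add: poly_inf_def)

lemma poly_inf_pCons [simp]: "poly_inf (pCons a p) = fls_const a + fls_X_inv * poly_inf p"
  by (cases "a = 0 \<and> p = 0") (auto simp: poly_inf_def map_poly_pCons)

lemma poly_inf_1 [simp]: "poly_inf 1 = 1"
  by (simp add: one_pCons)

lemma poly_inf_add [simp]: "poly_inf (p + q) = poly_inf p + poly_inf q"
  by (induction p q rule: poly_induct2) (simp_all add: algebra_simps flip: fls_plus_const)

lemma poly_inf_smult [simp]: "poly_inf (smult a p) = fls_const a * poly_inf p"
  by (induction p) (simp_all add: algebra_simps flip: fls_const_mult_const)

lemma poly_inf_minus [simp]: "poly_inf (- p) = - poly_inf p"
  using poly_inf_smult[of "-1" p] by (simp del: poly_inf_smult)

lemma poly_inf_diff [simp]: "poly_inf (p - q) = poly_inf p - poly_inf q"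
  using poly_inf_add[of p "- q"] by simp

lemma poly_inf_mult [simp]: "poly_inf (p * q) = poly_inf p * poly_inf q"
  by (induction p) (simp_all add: algebra_simps)

lemma poly_inf_power [simp]: "poly_inf (p ^ n) = poly_inf p ^ n"
  by (induction n) simp_all

lemma poly_inf_of_nat [simp]: "poly_inf (of_nat n) = of_nat n"
  by (induction n) simp_all

lemma poly_inf_numeral [simp]: "poly_inf (numeral n) = numeral n"
  using poly_inf_of_nat[of "numeral n"] by simp

lemma poly_inf_sixth_order_lhs:
  "poly_inf (sixth_order_lhs a z u) = sixth_order_lhs (poly_inf a) (poly_inf z) (\<lambda>k. poly_inf (u k))"
  by (simp add: sixth_order_lhs_def)

lemma poly_sixth_order_lhs:
  "poly (sixth_order_lhs a z u) x = sixth_order_lhs (poly a x) (poly z x) (\<lambda>k. poly (u k) x)"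
  by (simp add: sixth_order_lhs_def)

lemma deriv_inf_add [simp]: "deriv_inf (V + W) = deriv_inf V + deriv_inf W"
  by (simp add: deriv_inf_def algebra_simps)

lemma deriv_inf_mult: "deriv_inf (V * W) = deriv_inf V * W + V * deriv_inf W"
  by (simp add: deriv_inf_def algebra_simps)

lemma deriv_inf_const [simp]: "deriv_inf (fls_const a) = 0"
  by (simp add: deriv_inf_def)

lemma deriv_inf_0 [simp]: "deriv_inf 0 = 0"
  by (simp add: deriv_inf_def)

lemma deriv_inf_1 [simp]: "deriv_inf 1 = 0"
  by (simp add: deriv_inf_def)

lemma deriv_inf_X_inv [simp]: "deriv_inf fls_X_inv = 1"
proof -
  have "(fls_X :: complex fls) * fls_X_inv = 1"
    by (simp add: fls_X_times_conv_shift)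
  then have "(fls_X :: complex fls) ^ 2 * fls_X_inv ^ 2 = 1"
    by (metis power_mult_distrib power_one)
  then show ?thesis by (simp add: deriv_inf_def)
qed

lemma deriv_inf_power_Suc: "deriv_inf (V ^ Suc n) = of_nat (Suc n) * V ^ n * deriv_inf V"
  by (induction n) (simp_all add: deriv_inf_mult algebra_simps)

lemma deriv_inf_poly_inf: "deriv_inf (poly_inf p) = poly_inf (pderiv p)"
  by (induction p) (simp_all add: pderiv_pCons deriv_inf_mult)

section \<open>Power sums of roots and logarithmic derivatives\<close>

text \<open>The expansion in 1/z of the sum of 1/(z - a) over \<open>A\<close>; the m-th power sum
  sits at index m + 1.\<close>

definition powersum_series :: "complex multiset \<Rightarrow> complex fps" where
  "powersum_series A = Abs_fps (\<lambda>j. if j = 0 then 0 else \<Sum>a\<in>#A. a ^ (j - 1))"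

lemma powersum_series_add: "powersum_series (A + B) = powersum_series A + powersum_series B"
  by (simp add: powersum_series_def fps_eq_iff)

text \<open>Geometric series for 1/(z - a), first checked after dividing z - a by z, which gives 1 -
  a X.\<close>

lemma powersum_series_single:
  "fps_to_fls (powersum_series {#a#}) * (fls_X_inv - fls_const a) = 1"
proof -
  have "powersum_series {#a#} * (1 - fps_const a * fps_X) = fps_X"
  proof (rule fps_ext)
    fix j
    have "powersum_series {#a#} * (1 - fps_const a * fps_X)
        = powersum_series {#a#} - fps_const a * (fps_X * powersum_series {#a#})"
      by (simp add: algebra_simps)
    then show "(powersum_series {#a#} * (1 - fps_const a * fps_X)) $ j = fps_X $ j"
      by (cases j; cases "j - 1")
         (auto simp: powersum_series_def fps_X_mult_nth simp del: fps_X_mult_right_nth)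
  qed
  then have *: "fps_to_fls (powersum_series {#a#}) * (1 - fls_const a * fls_X) = fls_X"
    by (metis fls_times_fps_to_fls fps_to_fls_minus fps_one_to_fls fps_X_to_fls
        fps_const_to_fls)
  have "(fls_X :: complex fls) * fls_X_inv = 1"
    by (simp add: fls_X_times_conv_shift)
  moreover from this have "fls_X_inv - fls_const a = fls_X_inv * (1 - fls_const a * fls_X)"
    by (simp add: algebra_simps)
  ultimately show ?thesis using * by (metis mult.assoc mult.commute)
qed

text \<open>The logarithmic derivative of a product is the sum of those of its factors, written
  without division.\<close>

lemma poly_inf_prod_linear:
  "poly_inf (pderiv (\<Prod>a\<in>#A. [:- a, 1:]))
     = poly_inf (\<Prod>a\<in>#A. [:- a, 1:]) * fps_to_fls (powersum_series A)"
proof (induction A)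
  case empty
  have "powersum_series {#} = 0" by (simp add: powersum_series_def fps_eq_iff)
  then show ?case by simp
next
  case (add a A)
  have "powersum_series (add_mset a A) = powersum_series {#a#} + powersum_series A"
    using powersum_series_add[of "{#a#}" A] by simp
  moreover have "poly_inf [:- a, 1:] * fps_to_fls (powersum_series {#a#}) = 1"
    using powersum_series_single[of a] by (simp add: algebra_simps)
  moreover have "poly_inf (pderiv [:- a, 1:]) = 1" by (simp add: pderiv_pCons)
  \<comment> \<open>The induction step in abstract form: \<open>x\<close> is the new linear factor,
    \<open>t\<close> its inverse, \<open>p\<close> the old product and \<open>S\<close> its
    series.\<close>
  moreover have "x * (p * S) + p * 1 = x * p * (t + S)" if "x * t = 1" for x p S t :: "complex fls"
  proof -
    have "x * p * (t + S) = x * (p * S) + p * (x * t)"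
      by (simp add: algebra_simps)
    then show ?thesis using that by simp
  qed
  ultimately show ?case using add.IH
    by (simp only: image_mset_add_mset prod_mset.add_mset pderiv_mult poly_inf_add poly_inf_mult
        fps_to_fls_plus)
qed

lemma poly_inf_pderiv_monic:
  assumes "lead_coeff p = 1"
  shows "poly_inf (pderiv p) = poly_inf p * fps_to_fls (powersum_series (proots p))"
  using poly_inf_prod_linear[of "proots p"] complex_poly_decompose_multiset[of p] assms by simp

text \<open>Each linear factor is invertible by its geometric series, and Laurent series over a
  field have no zero divisors.\<close>

lemma poly_inf_monic_nonzero:
  assumes "lead_coeff p = 1"
  shows "poly_inf p \<noteq> 0"
proof -
  have "poly_inf [:- a, 1:] \<noteq> 0" for a
    using powersum_series_single[of a] by auto
  then have "poly_inf (\<Prod>a\<in>#A. [:- a, 1:]) \<noteq> 0" for A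
    by (induction A)
       (simp_all only: image_mset_empty prod_mset_empty poly_inf_1 one_neq_zero
          image_mset_add_mset prod_mset.add_mset poly_inf_mult mult_eq_0_iff simp_thms)
  then show ?thesis
    using complex_poly_decompose_multiset[of p] assms by (metis smult_1_left)
qed

section \<open>From rational solutions to their expansions\<close>

text \<open>The numerator of the \<open>k\<close>-th derivative of \<open>N / M\<close> over the denominator \<open>M ^ Suc k\<close>.\<close>

primrec quotient_deriv_num :: "complex poly \<Rightarrow> complex poly \<Rightarrow> nat \<Rightarrow> complex poly" where
  "quotient_deriv_num M N 0 = N"
| "quotient_deriv_num M N (Suc k) =
     pderiv (quotient_deriv_num M N k) * M - of_nat (Suc k) * quotient_deriv_num M N k * pderiv M"

text \<open>The quotient rule with cleared denominators. The numerators are the same polynomials as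
  for the analytic derivatives in \<open>higher_deriv_quotient\<close>; this links the two kinds of
  derivative.\<close>

lemma deriv_inf_quotient:
  assumes "poly_inf M * W = poly_inf N"
  shows "poly_inf M ^ Suc k * (deriv_inf ^^ k) W = poly_inf (quotient_deriv_num M N k)"
proof (induction k)
  case (Suc k)
  define U where "U = (deriv_inf ^^ k) W"
  have "poly_inf (pderiv (quotient_deriv_num M N k)) = deriv_inf (poly_inf M ^ Suc k * U)"
    by (simp only: U_def Suc deriv_inf_poly_inf)
  also have "\<dots> = of_nat (Suc k) * poly_inf M ^ k * poly_inf (pderiv M) * U
      + poly_inf M ^ Suc k * deriv_inf U"
    by (simp only: deriv_inf_mult deriv_inf_power_Suc deriv_inf_poly_inf)
  finally have "poly_inf (quotient_deriv_num M N (Suc k))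
      = (of_nat (Suc k) * poly_inf M ^ k * poly_inf (pderiv M) * U
         + poly_inf M ^ Suc k * deriv_inf U) * poly_inf M
        - of_nat (Suc k) * (poly_inf M ^ Suc k * U) * poly_inf (pderiv M)"
    by (simp only: quotient_deriv_num.simps poly_inf_diff poly_inf_mult poly_inf_of_nat
        Suc[folded U_def])
  also have "\<dots> = poly_inf M ^ Suc (Suc k) * deriv_inf U"
    by (simp add: algebra_simps del: of_nat_Suc)
  finally show ?case by (simp add: U_def)
qed (use assms in simp)

lemma higher_deriv_quotient:
  assumes "\<And>z. poly M z \<noteq> 0 \<Longrightarrow> f z = poly N z / poly M z"
    and "poly M z \<noteq> 0"
  shows "(deriv ^^ k) f z = poly (quotient_deriv_num M N k) z / poly M z ^ Suc k"
  using assms(2)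
proof (induction k arbitrary: z)
  case (Suc k)
  define P where "P = quotient_deriv_num M N k"
  \<comment> \<open>\<open>deriv\<close> depends only on values near \<open>z\<close>, and the
    induction hypothesis holds on a whole neighbourhood because the zeros of \<open>M\<close> form a
    closed set.\<close>
  have "open {z. poly M z \<noteq> 0}"
    by (intro open_Collect_neq continuous_intros)
  then have "\<forall>\<^sub>F x in nhds z. poly M x \<noteq> 0"
    using Suc.prems by (simp add: eventually_nhds) blast
  then have "\<forall>\<^sub>F x in nhds z. (deriv ^^ k) f x = poly P x / poly M x ^ Suc k"
    by eventually_elim (simp add: Suc.IH P_def)
  then have "deriv ((deriv ^^ k) f) z = deriv (\<lambda>x. poly P x / poly M x ^ Suc k) z"
    by (intro deriv_cong_ev) auto
  also have "((\<lambda>x. poly P x / poly M x ^ Suc k) has_field_derivative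
      (poly (pderiv P) z * poly M z ^ Suc k
         - poly P z * ((1 + of_nat k) * (poly (pderiv M) z * poly M z ^ k)))
       / (poly M z ^ Suc k * poly M z ^ Suc k)) (at z)"
    using Suc.prems by (intro DERIV_divide poly_DERIV DERIV_power_Suc) simp
  then have "deriv (\<lambda>x. poly P x / poly M x ^ Suc k) z
    = (poly (pderiv P) z * poly M z ^ Suc k
         - poly P z * ((1 + of_nat k) * (poly (pderiv M) z * poly M z ^ k)))
       / (poly M z ^ Suc k * poly M z ^ Suc k)"
    by (rule DERIV_imp_deriv)
  also have "\<dots> = (poly (pderiv P) z * poly M z - of_nat (Suc k) * poly P z * poly (pderiv M) z)
       / poly M z ^ Suc (Suc k)"
    using Suc.prems by (simp add: divide_simps) (simp add: algebra_simps)
  finally show ?case by (simp add: P_def del: of_nat_Suc)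
qed (use assms in simp)

lemma sixth_order_expansion:
  assumes M: "poly_inf M \<noteq> 0"
    and f: "\<And>z. poly M z \<noteq> 0 \<Longrightarrow> f z = poly N z / poly M z"
    and W: "poly_inf M * W = poly_inf N"
    and eq: "\<And>z. poly M z \<noteq> 0 \<Longrightarrow> sixth_order_lhs \<alpha> z (\<lambda>k. (deriv ^^ k) f z) = 0"
  shows "sixth_order_lhs (fls_const \<alpha>) fls_X_inv (\<lambda>k. (deriv_inf ^^ k) W) = 0"
proof -
  \<comment> \<open>By homogeneity \<open>E\<close> is \<open>M ^ 7\<close> times the left-hand side
    of the equation, for the function and for the series alike.\<close>
  define E where
    "E = sixth_order_lhs ([:\<alpha>:] * M ^ 7) ([:0, 1:] * M ^ 6) (quotient_deriv_num M N)"
  \<comment> \<open>The equation is known only off the zeros of \<open>M\<close>; the additional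
    factor \<open>M\<close> covers those zeros and is cancelled afterwards.\<close>
  have "poly (E * M) z = 0" for z
  proof (cases "poly M z = 0")
    case False
    have "poly M z ^ Suc k * (deriv ^^ k) f z = poly (quotient_deriv_num M N k) z" for k
      using False higher_deriv_quotient[of M f N z k, OF f] by simp
    then have "poly E z = poly M z ^ 7 * sixth_order_lhs \<alpha> z (\<lambda>k. (deriv ^^ k) f z)"
      unfolding E_def poly_sixth_order_lhs
      by (subst sixth_order_lhs_scale [symmetric]) simp
    with eq[OF False] show ?thesis by simp
  qed simp
  then have "E * M = 0" by (metis poly_all_0_iff_0)
  with M have "E = 0" by auto
  then have "0 = poly_inf E" by simp
  also have "\<dots> = poly_inf M ^ 7
      * sixth_order_lhs (fls_const \<alpha>) fls_X_inv (\<lambda>k. (deriv_inf ^^ k) W)"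
    unfolding E_def poly_inf_sixth_order_lhs
    by (subst sixth_order_lhs_scale [symmetric]) (simp only: deriv_inf_quotient[OF W], simp)
  finally show ?thesis using M by simp
qed

lemma log_deriv_poly_quotient:
  assumes "poly p z \<noteq> 0" "poly q z \<noteq> 0"
  shows "log_deriv (\<lambda>z. poly p z / poly q z) z
    = poly (pderiv p * q - p * pderiv q) z / poly (p * q) z"
proof -
  have "((\<lambda>z. poly p z / poly q z) has_field_derivative
      (poly (pderiv p) z * poly q z - poly p z * poly (pderiv q) z) / (poly q z * poly q z)) (at z)"
    using assms by (auto intro!: derivative_eq_intros)
  then show ?thesis
    unfolding log_deriv_def using assms by (simp add: DERIV_imp_deriv divide_simps)
qed

text \<open>w(z;n) is the logarithmic derivative of \<open>Q (n - 1)\<close> minus that of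
  \<open>Q n\<close>. The common denominator is the product of both polynomials, nonzero exactly
  where the equation is assumed.\<close>

lemma special_polynomials_expansion:
  assumes Q: "special_polynomials Q" and n: "n \<ge> 1"
  shows "sixth_order_lhs (fls_const (of_nat n)) fls_X_inv (\<lambda>k. (deriv_inf ^^ k)
    (fps_to_fls (powersum_series (proots (Q (n - 1))) - powersum_series (proots (Q n))))) = 0"
proof (rule sixth_order_expansion)
  let ?p = "Q (n - 1)" and ?q = "Q n"
  have monic: "lead_coeff ?p = 1" "lead_coeff ?q = 1"
    using Q unfolding special_polynomials_def by blast+
  show "poly_inf (?p * ?q) \<noteq> 0"
    using monic by (simp add: poly_inf_monic_nonzero)
  show "w_fun Q n z = poly (pderiv ?p * ?q - ?p * pderiv ?q) z / poly (?p * ?q) z"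
    if "poly (?p * ?q) z \<noteq> 0" for z
    using that by (simp add: w_fun_def log_deriv_poly_quotient)
  show "poly_inf (?p * ?q) * fps_to_fls (powersum_series (proots ?p) - powersum_series (proots ?q))
    = poly_inf (pderiv ?p * ?q - ?p * pderiv ?q)"
    using monic by (simp add: poly_inf_pderiv_monic algebra_simps)
  show "sixth_order_lhs (of_nat n) z (\<lambda>k. (deriv ^^ k) (w_fun Q n) z) = 0"
    if "poly (?p * ?q) z \<noteq> 0" for z
    using that Q n by (simp add: special_polynomials_def)
qed

section \<open>Telescoping the power sums\<close>

theorem theorem6p1:
  fixes Q :: "nat \<Rightarrow> complex poly" and n m :: nat
  assumes "special_polynomials Q"
    and "n \<ge> 2"
    and "m \<ge> 1"
  shows "(\<Sum>a\<in>#proots (Q n). a ^ m) = - (\<Sum>i = 2..n. c_inf (of_nat i) (- (int m + 1)))"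
proof -
  define s where "s i j = (\<Sum>a\<in>#proots (Q i). a ^ j)" for i j
  have nth: "(powersum_series (proots (Q (i - 1))) - powersum_series (proots (Q i))) $ Suc j
      = s (i - 1) j - s i j" for i j
    by (simp add: powersum_series_def s_def)
  have c: "c_inf (of_nat i) (- (int m + 1)) = s (i - 1) m - s i m" if "i \<ge> 1" for i
    using c_inf_eq_fps_nth(1)[OF special_polynomials_expansion[OF assms(1) that], of "Suc m"]
    unfolding nth by (simp add: minus_diff_commute)
  have s1: "s 1 m = 0"
  proof -
    have "size (proots (Q 1)) = 1"
      using assms(1) by (simp add: special_polynomials_def size_proots_complex)
    then obtain a where a: "proots (Q 1) = {#a#}" by (metis size_1_singleton_mset)
    \<comment> \<open>This is the coefficient at index 2 for \<alpha> = 1; it vanishes because 2 is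
      not congruent to 1 modulo 7. As \<open>Q 0\<close> has no roots, the root \<open>a\<close> of
      \<open>Q 1\<close> is then 0.\<close>
    have "s 0 1 - s 1 1 = 0"
      using c_inf_eq_fps_nth(2)[OF special_polynomials_expansion[OF assms(1) order_refl],
          of "Suc 1"]
        unfolding nth by auto
    moreover have "s 0 1 = 0"
      using assms(1) by (simp add: s_def special_polynomials_def)
    ultimately have "a = 0" by (simp add: s_def a del: One_nat_def)
    \<comment> \<open>\<open>m\<close> \<ge> 1 matters: for m = 0 the power sum would be 1.\<close>
    then show ?thesis using assms(3) by (simp add: s_def a del: One_nat_def)
  qed
  \<comment> \<open>The lower bound is written \<open>Suc 1\<close> to match the telescoping lemma,
    which is applied to the negated power sums.\<close>
  have "(\<Sum>i = 2..n. c_inf (of_nat i) (- (int m + 1))) = (\<Sum>i = Suc 1..n. s (i - 1) m - s i m)"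
    by (intro sum.cong c) auto
  also have "\<dots> = s 1 m - s n m"
    using sum_telescope''[of 1 n "\<lambda>i. - s i m"] assms(2) by simp
  finally show ?thesis unfolding s1 by (simp add: s_def)
qed

end
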